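(* Let $f:\{0,1\}^n\to\mathbb{R}$ with $\min_{x\in\{0,1\}^n}f(x)=0$ and $\max_{x\in\{0,1\}^n}f(x)=1$, and let $\mathbb{P}$ be the unconstrained problem $\min\{f(x)\mid x\in\{0,1\}^n\}$, with optimal value $f(x_{I^*})$. The Lasserre relaxation $\mathrm{Las}_{n-1}(\mathbb{P})$ has an integrality gap if and only if there exist real numbers $\{y_I^N\mid I\subseteq N\}$ such that: $\sum_{I\subseteq N}y_I^Nf(x_I)<f(x_{I^*})$; $\sum_{I\subseteq N}y_I^N=1$; $y_K^N<0$ for exactly one $K\subseteq N$; $y_J^N>0$ for all $J\subseteq N$ with $J\neq K$; and $\sum_{I\subseteq N}\frac{1}{y_I^N}\le0$.
   Context: $N=\{1,\dots,n\}$. For $I\subseteq N$, $x_I\in\{0,1\}^n$ has $x_i=1$ iff $i\in I$. Write $f$ as the multilinear polynomial $\sum_{I\subseteq N}f_I\prod_{i\in I}x_i$. $\mathcal{P}_t(N)$ is the set of subsets of $N$ of size at most $t$; $M_t(y)$ is the matrix indexed by $\mathcal{P}_t(N)$ with $(I,J)$-entry $y_{I\cup J}$. For an unconstrained problem, $\mathrm{Las}_t(\mathbb{P})=\min\{\sum_If_Iy_I\mid y\in\mathbb{R}^{\mathcal{P}_{2t}(N)},\ y_\varnothing=1,\ M_t(y)\succeq0\}$. For $y$ indexed by all subsets of $N$, $y_I^N=\sum_{H\subseteq N\setminus I}(-1)^{|H|}y_{H\cup I}$, and $\sum_If_Iy_I=\sum_{I\subseteq N}f(x_I)y_I^N$.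 The relaxation has an integrality gap if its optimal value is strictly smaller than $\min_x f(x)$. *)

theory Defs
  imports "HOL-Analysis.Analysis"
begin

text \<open>The ground set is \<open>N = {1..n}\<close>; a point of \<open>{0,1}\<^sup>n\<close> is an extensional function
  on \<open>{1..n}\<close>, so the cube is a finite set.\<close>

definition cube :: "nat \<Rightarrow> (nat \<Rightarrow> real) set" where
  "cube n = ({1..n} \<rightarrow>\<^sub>E {0, 1})"

definition ind_point :: "nat \<Rightarrow> nat set \<Rightarrow> (nat \<Rightarrow> real)" where
  "ind_point n I = (\<lambda>i\<in>{1..n}. if i \<in> I then 1 else 0)"

text \<open>The value outside \<open>Pow {1..n}\<close> is fixed to 0 so that the coefficient family is unique
  (lemma \<open>ex1_multilinear_coeffs\<close>).\<close>

definition is_multilinear_coeffs ::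
  "nat \<Rightarrow> ((nat \<Rightarrow> real) \<Rightarrow> real) \<Rightarrow> (nat set \<Rightarrow> real) \<Rightarrow> bool" where
  "is_multilinear_coeffs n f c \<longleftrightarrow>
     (\<forall>x\<in>cube n. f x = (\<Sum>I\<in>Pow {1..n}. c I * (\<Prod>i\<in>I. x i))) \<and>
     (\<forall>I. \<not> I \<subseteq> {1..n} \<longrightarrow> c I = 0)"

definition multilinear_coeff :: "nat \<Rightarrow> ((nat \<Rightarrow> real) \<Rightarrow> real) \<Rightarrow> nat set \<Rightarrow> real" where
  "multilinear_coeff n f = (THE c. is_multilinear_coeffs n f c)"

definition subsets_upto :: "nat \<Rightarrow> nat \<Rightarrow> nat set set" where
  "subsets_upto n t = {I. I \<subseteq> {1..n} \<and> card I \<le> t}"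

definition psd_on :: "'a set \<Rightarrow> ('a \<Rightarrow> 'a \<Rightarrow> real) \<Rightarrow> bool" where
  "psd_on A M \<longleftrightarrow>
     (\<forall>i\<in>A. \<forall>j\<in>A. M i j = M j i) \<and>
     (\<forall>v. 0 \<le> (\<Sum>i\<in>A. \<Sum>j\<in>A. v i * M i j * v j))"

definition moment_matrix :: "(nat set \<Rightarrow> real) \<Rightarrow> nat set \<Rightarrow> nat set \<Rightarrow> real" where
  "moment_matrix y I J = y (I \<union> J)"

text \<open>A vector in \<open>\<real>\<close> to the power \<open>\<P>\<^bsub>2t\<^esub>(N)\<close> is a total function on sets: only entries at
  sets of size at most \<open>2 * t\<close> occur in the constraints. The objective refers to the same entries
  as soon as \<open>2 * t\<close> is at least the degree of \<open>f\<close>; otherwise the remaining entries are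
  unconstrained variables.\<close>

definition las_feasible :: "nat \<Rightarrow> nat \<Rightarrow> (nat set \<Rightarrow> real) set" where
  "las_feasible n t = {y. y {} = 1 \<and> psd_on (subsets_upto n t) (moment_matrix y)}"

definition las_objective :: "nat \<Rightarrow> ((nat \<Rightarrow> real) \<Rightarrow> real) \<Rightarrow> (nat set \<Rightarrow> real) \<Rightarrow> real" where
  "las_objective n f y = (\<Sum>I\<in>Pow {1..n}. multilinear_coeff n f I * y I)"

text \<open>The optimal value is an infimum in the extended reals, hence it is \<open>-\<infinity>\<close> for an unbounded
  relaxation and equals the minimum whenever the minimum is attained.\<close>

definition las_value :: "nat \<Rightarrow> nat \<Rightarrow> ((nat \<Rightarrow> real) \<Rightarrow> real) \<Rightarrow> ereal" where
  "las_value n t f = (INF y\<in>las_feasible n t. ereal (las_objective n f y))"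

definition las_integrality_gap :: "nat \<Rightarrow> nat \<Rightarrow> ((nat \<Rightarrow> real) \<Rightarrow> real) \<Rightarrow> bool" where
  "las_integrality_gap n t f \<longleftrightarrow> las_value n t f < ereal (Min (f ` cube n))"

lemma cube_eq_ind_points: "cube n = ind_point n ` Pow {1..n}"
proof
  show "cube n \<subseteq> ind_point n ` Pow {1..n}"
  proof
    fix x assume x: "x \<in> cube n"
    have "x = ind_point n {i\<in>{1..n}. x i = 1}"
    proof
      fix i show "x i = ind_point n {i\<in>{1..n}. x i = 1} i"
        using x by (cases "i \<in> {1..n}") (auto simp: cube_def ind_point_def PiE_iff extensional_def)
    qed
    then show "x \<in> ind_point n ` Pow {1..n}" by blast
  qed
  show "ind_point n ` Pow {1..n} \<subseteq> cube n"
    by (auto simp: cube_def ind_point_def split: if_splits)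
qed

lemma multilinear_at_ind_point:
  assumes S: "S \<subseteq> {1..n}"
  shows "(\<Sum>I\<in>Pow {1..n}. c I * (\<Prod>i\<in>I. ind_point n S i)) = (\<Sum>I\<in>Pow S. c I)"
proof -
  have fin: "finite I" if "I \<subseteq> {1..n}" for I :: "nat set"
    using that finite_subset by blast
  have P: "(\<Prod>i\<in>I. ind_point n S i) = (if I \<subseteq> S then 1 else 0)" if I: "I \<subseteq> {1..n}" for I
  proof (cases "I \<subseteq> S")
    case True
    have "(\<Prod>i\<in>I. ind_point n S i) = (\<Prod>i\<in>I. 1)"
      using I True by (intro prod.cong) (auto simp: ind_point_def)
    then show ?thesis using True by simp
  next
    case False
    then obtain j where j: "j \<in> I" "j \<notin> S" by blast
    then have "ind_point n S j = 0" using I by (auto simp: ind_point_def)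
    then have "\<exists>i\<in>I. ind_point n S i = 0" using j by blast
    then show ?thesis using False fin[OF I] by simp
  qed
  have "(\<Sum>I\<in>Pow {1..n}. c I * (\<Prod>i\<in>I. ind_point n S i))
      = (\<Sum>I\<in>Pow {1..n}. if I \<in> Pow S then c I else 0)"
    by (intro sum.cong) (auto simp: P)
  also have "\<dots> = (\<Sum>I\<in>Pow {1..n} \<inter> Pow S. c I)"
    by (simp add: sum.inter_restrict)
  also have "Pow {1..n} \<inter> Pow S = Pow S" using S by blast
  finally show ?thesis .
qed

lemma ex1_multilinear_coeffs: "\<exists>!c. is_multilinear_coeffs n f c"
proof (rule ex_ex1I)
  define F where "F S = f (ind_point n S)" for S
  define g where "g S = (\<Sum>T\<in>Pow S. (-1) ^ card T * F T)" for S
  define c where "c T = (if T \<subseteq> {1..n} then (-1) ^ card T * g T else 0)" for T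
  have F: "F S = (\<Sum>T\<in>Pow S. c T)" if S: "S \<subseteq> {1..n}" for S
  proof -
    have "finite S" using S finite_subset by blast
    then have "F S = (\<Sum>T\<in>Pow S. (-1) ^ card T * g T)"
      by (rule inclusion_exclusion_symmetric[rotated]) (rule g_def)
    also have "\<dots> = (\<Sum>T\<in>Pow S. c T)"
      using S by (intro sum.cong) (auto simp: c_def)
    finally show ?thesis .
  qed
  have "f x = (\<Sum>I\<in>Pow {1..n}. c I * (\<Prod>i\<in>I. x i))" if x: "x \<in> cube n" for x
  proof -
    obtain S where S: "S \<subseteq> {1..n}" and xS: "x = ind_point n S"
      using x unfolding cube_eq_ind_points by blast
    show ?thesis
      unfolding xS multilinear_at_ind_point[OF S] using F[OF S] unfolding F_def .
  qed
  moreover have "c I = 0" if "\<not> I \<subseteq> {1..n}" for I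
    using that unfolding c_def by (rule if_not_P)
  ultimately have "is_multilinear_coeffs n f c"
    unfolding is_multilinear_coeffs_def by blast
  then show "\<exists>c. is_multilinear_coeffs n f c" by (rule exI[where x = c])
next
  fix c d assume cd: "is_multilinear_coeffs n f c" "is_multilinear_coeffs n f d"
  have rep: "f (ind_point n (S \<inter> {1..n})) = sum e (Pow S)"
    if e: "is_multilinear_coeffs n f e" and "finite S" for e S
  proof -
    have "f (ind_point n (S \<inter> {1..n})) = sum e (Pow (S \<inter> {1..n}))"
    proof -
      have "ind_point n (S \<inter> {1..n}) \<in> cube n"
        unfolding cube_eq_ind_points by blast
      then show ?thesis
        using e multilinear_at_ind_point[of "S \<inter> {1..n}" n e]
        unfolding is_multilinear_coeffs_def by (metis Int_lower2)
    qed
    also have "\<dots> = sum e (Pow S)"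
      using e \<open>finite S\<close> by (intro sum.mono_neutral_left) (auto simp: is_multilinear_coeffs_def)
    finally show ?thesis .
  qed
  show "c = d"
  proof
    fix I show "c I = d I"
    proof (cases "I \<subseteq> {1..n}")
      case True
      then have "finite I" using finite_subset by blast
      then show ?thesis
        using inclusion_exclusion_mobius[OF rep[OF cd(1)], of I]
          inclusion_exclusion_mobius[OF rep[OF cd(2)], of I]
        by (rule_tac trans[OF _ sym])
    next
      case False
      then show ?thesis using cd by (simp add: is_multilinear_coeffs_def)
    qed
  qed
qed

lemma multilinear_coeff: "is_multilinear_coeffs n f (multilinear_coeff n f)"
  unfolding multilinear_coeff_def by (rule theI'[OF ex1_multilinear_coeffs])

end

theory Submission
  imports Defs
begin

text \<open>In the coordinates \<open>z S = y\<^sup>N\<^sub>S\<close> the quadratic form of the moment matrix at a vector \<open>v\<close> is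
  \<open>\<Sum>S. z S * (p S)\<^sup>2\<close> with \<open>p S = (\<Sum>I\<subseteq>S. v I)\<close>. Excluding the index \<open>N\<close> from \<open>v\<close> means that \<open>p\<close>
  ranges over the hyperplane \<open>(\<Sum>S. (-1)^card S * p S) = 0\<close>. If a diagonal form
  is nonnegative on this hyperplane and has a negative entry, which a gap forces because \<open>f \<ge> 0\<close>,
  then all its other entries are positive; by Cauchy-Schwarz a form with exactly one
  negative entry and all others positive is nonnegative there iff its reciprocals sum to at most 0.\<close>

section \<open>Diagonal quadratic forms on a hyperplane\<close>

text \<open>Two kinds of test vectors in the hyperplane suffice: one supported on \<open>K\<close>
  and \<open>J\<close> forces \<open>z J\<close> to be at least \<open>- z K\<close>, and one with
  entries \<open>\<epsilon> S / z S\<close> off \<open>K\<close> bounds the reciprocals.\<close>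

lemma negative_entry_of_hyperplane_nonneg:
  fixes z \<epsilon> :: "'a \<Rightarrow> real"
  assumes fin: "finite A" and \<epsilon>: "\<And>S. S \<in> A \<Longrightarrow> \<epsilon> S * \<epsilon> S = 1"
    and nonneg: "\<And>p. (\<Sum>S\<in>A. \<epsilon> S * p S) = 0 \<Longrightarrow> 0 \<le> (\<Sum>S\<in>A. z S * (p S)\<^sup>2)"
    and K: "K \<in> A" "z K < 0"
  shows "\<forall>J\<in>A - {K}. 0 < z J" and "A \<noteq> {K} \<Longrightarrow> (\<Sum>S\<in>A. 1 / z S) \<le> 0"
proof -
  have \<epsilon>2: "(\<epsilon> S)\<^sup>2 = 1" if "S \<in> A" for S
    using \<epsilon>[OF that] by (simp add: power2_eq_square)
  show pos: "\<forall>J\<in>A - {K}. 0 < z J"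
  proof
    fix J assume J: "J \<in> A - {K}"
    \<comment> \<open>The two entries cancel in the hyperplane equation and their squares are 1, so
      the form reduces to \<open>z K + z J\<close>.\<close>
    define p where "p S = (if S = K then \<epsilon> K else if S = J then - \<epsilon> J else 0)" for S
    have split: "(\<Sum>S\<in>A. g S) = g K + (g J + (\<Sum>S\<in>A - {K} - {J}. g S))" for g :: "'a \<Rightarrow> real"
      using fin K J by (simp add: sum.remove[of A K] sum.remove[of "A - {K}" J])
    have "(\<Sum>S\<in>A. \<epsilon> S * p S) = 0"
      using J K \<epsilon> unfolding split by (simp add: p_def sum.neutral)
    then have "0 \<le> (\<Sum>S\<in>A. z S * (p S)\<^sup>2)" by (rule nonneg)
    also have "\<dots> = z K + z J"
      using J K \<epsilon>2 unfolding split by (simp add: p_def sum.neutral)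
    finally show "0 < z J" using K by linarith
  qed
  show "(\<Sum>S\<in>A. 1 / z S) \<le> 0" if ne: "A \<noteq> {K}"
  proof -
    define a where "a = (\<Sum>S\<in>A - {K}. 1 / z S)"
    have "A - {K} \<noteq> {}" using ne K by blast
    then have a: "0 < a"
      unfolding a_def using fin pos by (intro sum_pos) auto
    \<comment> \<open>the equality case of Cauchy-Schwarz\<close>
    define p where "p S = (if S = K then - \<epsilon> K * a else \<epsilon> S / z S)" for S
    have "(\<Sum>S\<in>A - {K}. \<epsilon> S * p S) = a"
      unfolding a_def using \<epsilon> by (intro sum.cong) (auto simp: p_def)
    then have "(\<Sum>S\<in>A. \<epsilon> S * p S) = 0"
      using fin K \<epsilon>[of K] by (simp add: sum.remove[of A K] p_def)
    then have "0 \<le> (\<Sum>S\<in>A. z S * (p S)\<^sup>2)" by (rule nonneg)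
    also have "\<dots> = z K * a\<^sup>2 + (\<Sum>S\<in>A - {K}. z S * (p S)\<^sup>2)"
      using fin K \<epsilon>2[of K] by (simp add: sum.remove[of A K] p_def power_mult_distrib)
    also have "(\<Sum>S\<in>A - {K}. z S * (p S)\<^sup>2) = a"
      unfolding a_def using \<epsilon>2 pos
      by (intro sum.cong) (auto simp: p_def power_divide power2_eq_square)
    finally have "0 \<le> a * (z K * a + 1)"
      by (simp add: algebra_simps power2_eq_square)
    then have "0 \<le> z K * a + 1"
      using a by (simp add: zero_le_mult_iff)
    \<comment> \<open>Dividing by the negative number \<open>z K\<close> reverses the
      inequality.\<close>
    then have "1 / z K + a \<le> 0"
      using K by (simp add: field_simps)
    then show ?thesis using fin K by (simp add: sum.remove[of A K] a_def)
  qed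
qed

text \<open>The hyperplane equation expresses \<open>p K\<close> through the other entries, and
  Cauchy-Schwarz bounds its square by \<open>a * b\<close>, where \<open>b\<close> is the positive
  part of the form. The reciprocal condition amounts to \<open>- z K * a \<le> 1\<close>, so the
  negative term has size at most \<open>b\<close>.\<close>

lemma hyperplane_nonneg_of_negative_entry:
  fixes z \<epsilon> p :: "'a \<Rightarrow> real"
  assumes fin: "finite A" and \<epsilon>: "\<And>S. S \<in> A \<Longrightarrow> \<epsilon> S * \<epsilon> S = 1"
    and K: "K \<in> A" "z K < 0" and pos: "\<And>J. J \<in> A - {K} \<Longrightarrow> 0 < z J"
    and recip: "(\<Sum>S\<in>A. 1 / z S) \<le> 0"
    and p: "(\<Sum>S\<in>A. \<epsilon> S * p S) = 0"
  shows "0 \<le> (\<Sum>S\<in>A. z S * (p S)\<^sup>2)"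
proof -
  have \<epsilon>2: "(\<epsilon> S)\<^sup>2 = 1" if "S \<in> A" for S
    using \<epsilon>[OF that] by (simp add: power2_eq_square)
  define a b where "a = (\<Sum>S\<in>A - {K}. 1 / z S)" and "b = (\<Sum>S\<in>A - {K}. z S * (p S)\<^sup>2)"
  have b: "0 \<le> b"
    unfolding b_def using pos by (intro sum_nonneg) (simp add: less_imp_le)
  have "(p K)\<^sup>2 = (\<epsilon> K * p K)\<^sup>2"
    using \<epsilon>2 K by (simp add: power_mult_distrib)
  also have "\<epsilon> K * p K = - (\<Sum>S\<in>A - {K}. \<epsilon> S * p S)"
    using p fin K by (simp add: sum.remove[of A K])
  \<comment> \<open>The weights \<open>sqrt (z S)\<close> are chosen so that the two sums of squares
    in Cauchy-Schwarz become \<open>a\<close> and \<open>b\<close>.\<close>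
  also have "(\<Sum>S\<in>A - {K}. \<epsilon> S * p S)
      = (\<Sum>S\<in>A - {K}. (\<epsilon> S / sqrt (z S)) * (sqrt (z S) * p S))"
    using pos by (intro sum.cong refl) fastforce
  also have "(- \<dots>)\<^sup>2 \<le> (\<Sum>S\<in>A - {K}. (\<epsilon> S / sqrt (z S))\<^sup>2) * (\<Sum>S\<in>A - {K}. (sqrt (z S) * p S)\<^sup>2)"
    unfolding power2_minus by (rule Cauchy_Schwarz_ineq_sum)
  also have "(\<Sum>S\<in>A - {K}. (\<epsilon> S / sqrt (z S))\<^sup>2) = a"
    unfolding a_def using \<epsilon>2 pos
    by (intro sum.cong refl) (simp add: power_divide less_imp_le)
  also have "(\<Sum>S\<in>A - {K}. (sqrt (z S) * p S)\<^sup>2) = b"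
    unfolding b_def using pos
    by (intro sum.cong refl) (simp add: power_mult_distrib less_imp_le)
  finally have pK: "(p K)\<^sup>2 \<le> a * b" .
  have "1 / z K + a \<le> 0" using recip fin K by (simp add: sum.remove[of A K] a_def)
  then have "- z K * a \<le> 1" using K by (simp add: field_simps)
  then have "- z K * a * b \<le> 1 * b" using b by (rule mult_right_mono)
  moreover have "- z K * (p K)\<^sup>2 \<le> - z K * (a * b)"
    using pK K by (intro mult_left_mono) auto
  ultimately have "0 \<le> z K * (p K)\<^sup>2 + b" by (simp add: algebra_simps)
  then show ?thesis using fin K by (simp add: sum.remove[of A K] b_def)
qed

section \<open>Moebius inversion on subsets\<close>

lemma ex_subset_sum_coeffs:
  fixes F :: "'a set \<Rightarrow> real"
  obtains c where "\<And>S. finite S \<Longrightarrow> F S = sum c (Pow S)"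
proof -
  define g where "g S = (\<Sum>T\<in>Pow S. (-1) ^ card T * F T)" for S
  have "F S = (\<Sum>T\<in>Pow S. (-1) ^ card T * g T)" if "finite S" for S
    using that by (rule inclusion_exclusion_symmetric[rotated]) (rule g_def)
  then show ?thesis by (rule that)
qed

text \<open>Complementation in \<open>N\<close> turns superset sums into subset sums. The superset
  relation is triangular and determines \<open>z\<close> on subsets of \<open>N\<close>, so
  \<open>z S\<close> is \<open>y\<^sup>N\<^sub>S\<close>.\<close>

lemma ex_superset_sum_coeffs:
  fixes y :: "'a set \<Rightarrow> real"
  assumes N: "finite N"
  obtains z where "\<And>I. I \<subseteq> N \<Longrightarrow> y I = (\<Sum>S | I \<subseteq> S \<and> S \<subseteq> N. z S)"
proof -
  obtain c where c: "\<And>S. finite S \<Longrightarrow> y (N - S) = sum c (Pow S)"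
    using ex_subset_sum_coeffs[of "\<lambda>S. y (N - S)"] by blast
  have "y I = (\<Sum>S | I \<subseteq> S \<and> S \<subseteq> N. c (N - S))" if I: "I \<subseteq> N" for I
  proof -
    have "y I = sum c (Pow (N - I))"
      using c[of "N - I"] N I by (simp add: double_diff)
    also have "\<dots> = (\<Sum>S | I \<subseteq> S \<and> S \<subseteq> N. c (N - S))"
      using I by (intro sum.reindex_bij_witness[of _ "\<lambda>S. N - S" "\<lambda>S. N - S"])
        (auto intro!: arg_cong[of _ _ c])
    finally show ?thesis .
  qed
  then show ?thesis by (rule that)
qed

text \<open>Moebius inversion at the top set \<open>N\<close>. Hence subset sums of \<open>c\<close>
  satisfy the hyperplane equation exactly when \<open>c N = 0\<close>.\<close>

lemma alternating_sum_subset_sums: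
  fixes c :: "'a set \<Rightarrow> real"
  assumes "finite N"
  shows "(\<Sum>S\<in>Pow N. (-1) ^ card S * sum c (Pow S)) = (-1) ^ card N * c N"
proof -
  have "sum c (Pow S) = (\<Sum>T\<in>Pow S. (-1) ^ card T * ((-1) ^ card T * c T))" for S
    by (simp add: mult.assoc[symmetric] power_add[symmetric])
  then show ?thesis
    using inclusion_exclusion_symmetric[of "\<lambda>S. sum c (Pow S)" "\<lambda>T. (-1) ^ card T * c T" N] assms
    by simp
qed

section \<open>Moment matrices in the coordinates \<open>z\<close>\<close>

context
  fixes N :: "nat set" and y z :: "nat set \<Rightarrow> real"
  assumes N: "finite N" and y: "\<And>I. I \<subseteq> N \<Longrightarrow> y I = (\<Sum>S | I \<subseteq> S \<and> S \<subseteq> N. z S)"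
begin

text \<open>Interchange of summation over pairs with \<open>I \<subseteq> S\<close>. For multilinear
  coefficients \<open>c\<close>, the subset sums are the values of the polynomial at the 0/1
  points.\<close>

lemma sum_superset_moments:
  "(\<Sum>I\<in>Pow N. c I * y I) = (\<Sum>S\<in>Pow N. z S * sum c (Pow S))"
proof -
  have "(\<Sum>I\<in>Pow N. c I * y I) = (\<Sum>I\<in>Pow N. \<Sum>S | S \<in> Pow N \<and> I \<subseteq> S. c I * z S)"
    by (intro sum.cong refl) (auto simp: y sum_distrib_left intro!: sum.cong)
  also have "\<dots> = (\<Sum>S\<in>Pow N. \<Sum>I | I \<in> Pow N \<and> I \<subseteq> S. c I * z S)"
    using N by (intro sum.swap_restrict) auto
  also have "\<dots> = (\<Sum>S\<in>Pow N. z S * sum c (Pow S))"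
    by (intro sum.cong refl) (auto simp: sum_distrib_left mult.commute intro!: sum.cong)
  finally show ?thesis .
qed

text \<open>Each \<open>S\<close> contributes a rank-one form, the square of
  \<open>sum v (Pow S)\<close> scaled by \<open>z S\<close>. Since \<open>v N = 0\<close>, the index
  \<open>N\<close> can be added to both ranges at no cost.\<close>

lemma moment_quadratic_form:
  assumes v: "v N = 0"
  shows "(\<Sum>I\<in>Pow N - {N}. \<Sum>J\<in>Pow N - {N}. v I * moment_matrix y I J * v J)
    = (\<Sum>S\<in>Pow N. z S * (sum v (Pow S))\<^sup>2)" (is "?L = _")
proof -
  have y': "y I = (\<Sum>S\<in>Pow N. z S * of_bool (I \<subseteq> S))" if "I \<subseteq> N" for I
    using N that by (auto simp: y intro!: sum.mono_neutral_cong_left)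
  have p: "(\<Sum>I\<in>Pow N. v I * of_bool (I \<subseteq> S)) = sum v (Pow S)" if "S \<subseteq> N" for S
    using N that by (auto intro!: sum.mono_neutral_cong_right)
  have "?L = (\<Sum>I\<in>Pow N. \<Sum>J\<in>Pow N. v I * moment_matrix y I J * v J)"
    using N by (simp add: v sum.remove[of "Pow N" N])
  \<comment> \<open>The indicator of \<open>I \<union> J \<subseteq> S\<close> is the product of
    those of \<open>I \<subseteq> S\<close> and \<open>J \<subseteq> S\<close>.\<close>
  also have "\<dots> = (\<Sum>I\<in>Pow N. \<Sum>J\<in>Pow N. \<Sum>S\<in>Pow N.
      z S * ((v I * of_bool (I \<subseteq> S)) * (v J * of_bool (J \<subseteq> S))))"
    by (intro sum.cong refl)
      (auto simp: moment_matrix_def y' sum_distrib_left sum_distrib_right intro!: sum.cong)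
  also have "\<dots> = (\<Sum>I\<in>Pow N. \<Sum>S\<in>Pow N. \<Sum>J\<in>Pow N.
      z S * ((v I * of_bool (I \<subseteq> S)) * (v J * of_bool (J \<subseteq> S))))"
    by (intro sum.cong[OF refl] sum.swap)
  also have "\<dots> = (\<Sum>S\<in>Pow N. \<Sum>I\<in>Pow N. \<Sum>J\<in>Pow N.
      z S * ((v I * of_bool (I \<subseteq> S)) * (v J * of_bool (J \<subseteq> S))))"
    by (rule sum.swap)
  also have "\<dots> = (\<Sum>S\<in>Pow N. z S * (sum v (Pow S))\<^sup>2)"
    by (intro sum.cong refl)
      (simp add: p[symmetric] power2_eq_square sum_product, simp only: sum_distrib_left)
  finally show ?thesis .
qed

text \<open>Passing from \<open>v\<close> to its subset sums is invertible and carries the condition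
  \<open>v N = 0\<close> to the hyperplane equation.\<close>

lemma psd_moment_matrix_iff:
  "psd_on (Pow N - {N}) (moment_matrix y) \<longleftrightarrow>
    (\<forall>p. (\<Sum>S\<in>Pow N. (-1) ^ card S * p S) = 0 \<longrightarrow> 0 \<le> (\<Sum>S\<in>Pow N. z S * (p S)\<^sup>2))"
    (is "?psd \<longleftrightarrow> ?nonneg")
proof
  assume psd: ?psd
  show ?nonneg
  proof (intro allI impI)
    fix p :: "nat set \<Rightarrow> real" assume p: "(\<Sum>S\<in>Pow N. (-1) ^ card S * p S) = 0"
    obtain v where v: "\<And>S. finite S \<Longrightarrow> p S = sum v (Pow S)"
      using ex_subset_sum_coeffs[of p] by blast
    have sums: "(\<Sum>S\<in>Pow N. g S (p S)) = (\<Sum>S\<in>Pow N. g S (sum v (Pow S)))"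
      for g :: "nat set \<Rightarrow> real \<Rightarrow> real"
      using N by (intro sum.cong refl) (metis PowD finite_subset v)
    have "v N = 0"
      using p alternating_sum_subset_sums[OF N, of v] sums[of "\<lambda>S x. (-1) ^ card S * x"] by simp
    then have "(\<Sum>S\<in>Pow N. z S * (p S)\<^sup>2)
        = (\<Sum>I\<in>Pow N - {N}. \<Sum>J\<in>Pow N - {N}. v I * moment_matrix y I J * v J)"
      using moment_quadratic_form sums[of "\<lambda>S x. z S * x\<^sup>2"] by simp
    then show "0 \<le> (\<Sum>S\<in>Pow N. z S * (p S)\<^sup>2)"
      using psd by (simp add: psd_on_def)
  qed
next
  assume nonneg: ?nonneg
  have "0 \<le> (\<Sum>I\<in>Pow N - {N}. \<Sum>J\<in>Pow N - {N}. v I * moment_matrix y I J * v J)" for v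
  proof -
    \<comment> \<open>A test vector is a total function, so its value at the excluded index
      \<open>N\<close> is arbitrary and is reset to 0.\<close>
    define w where "w = v(N := 0)"
    have "0 \<le> (\<Sum>S\<in>Pow N. z S * (sum w (Pow S))\<^sup>2)"
      using nonneg[rule_format, of "\<lambda>S. sum w (Pow S)"] alternating_sum_subset_sums[OF N, of w]
      by (simp add: w_def)
    also have "\<dots> = (\<Sum>I\<in>Pow N - {N}. \<Sum>J\<in>Pow N - {N}. w I * moment_matrix y I J * w J)"
      by (rule moment_quadratic_form[symmetric]) (simp add: w_def)
    also have "\<dots> = (\<Sum>I\<in>Pow N - {N}. \<Sum>J\<in>Pow N - {N}. v I * moment_matrix y I J * v J)"
      by (intro sum.cong refl) (auto simp: w_def)
    finally show ?thesis .
  qed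
  then show ?psd by (auto simp: psd_on_def moment_matrix_def Un_commute)
qed

end

section \<open>The relaxation at level \<open>n - 1\<close>\<close>

text \<open>Only the full set has more than \<open>n - 1\<close> elements. For \<open>n = 0\<close>
  truncated subtraction would keep the empty set, which is then the full set.\<close>

lemma subsets_upto_pred:
  assumes "n \<ge> 1"
  shows "subsets_upto n (n - 1) = Pow {1..n} - {{1..n}}"
proof -
  have "card I \<le> n - 1 \<longleftrightarrow> I \<noteq> {1..n}" if "I \<subseteq> {1..n}" for I
    using card_mono[OF finite_atLeastAtMost that] card_subset_eq[OF finite_atLeastAtMost that] assms
    by fastforce
  then show ?thesis
    unfolding subsets_upto_def by blast
qed

lemma las_objective_eq:
  assumes "\<And>I. I \<subseteq> {1..n} \<Longrightarrow> y I = (\<Sum>S | I \<subseteq> S \<and> S \<subseteq> {1..n}. z S)"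
  shows "las_objective n f y = (\<Sum>S\<in>Pow {1..n}. z S * f (ind_point n S))"
proof -
  have "f (ind_point n S) = sum (multilinear_coeff n f) (Pow S)" if "S \<subseteq> {1..n}" for S
    using that multilinear_coeff[of n f] multilinear_at_ind_point[OF that]
    unfolding is_multilinear_coeffs_def cube_eq_ind_points by auto
  then have "(\<Sum>S\<in>Pow {1..n}. z S * f (ind_point n S))
      = (\<Sum>S\<in>Pow {1..n}. z S * sum (multilinear_coeff n f) (Pow S))"
    by (intro sum.cong) auto
  then show ?thesis
    unfolding las_objective_def
    using sum_superset_moments[OF finite_atLeastAtMost assms, of "multilinear_coeff n f"] by metis
qed

theorem theorem2:
  fixes n :: nat
    and f :: "(nat \<Rightarrow> real) \<Rightarrow> real"
    and Iopt :: "nat set"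
  assumes "n \<ge> 1"
    and "Min (f ` cube n) = 0"
    and "Max (f ` cube n) = 1"
    and "Iopt \<subseteq> {1..n}"
    and "f (ind_point n Iopt) = Min (f ` cube n)"
  shows "las_integrality_gap n (n - 1) f \<longleftrightarrow>
    (\<exists>yN :: nat set \<Rightarrow> real.
       (\<Sum>I\<in>Pow {1..n}. yN I * f (ind_point n I)) < f (ind_point n Iopt) \<and>
       (\<Sum>I\<in>Pow {1..n}. yN I) = 1 \<and>
       (\<exists>K. K \<subseteq> {1..n} \<and> yN K < 0 \<and> (\<forall>J. J \<subseteq> {1..n} \<and> J \<noteq> K \<longrightarrow> yN J > 0)) \<and>
       (\<Sum>I\<in>Pow {1..n}. 1 / yN I) \<le> 0)"
    (is "_ \<longleftrightarrow> (\<exists>z. ?obj z \<and> ?one z \<and> ?neg z \<and> ?recip z)")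
proof -
  let ?N = "{1..n}"
  \<comment> \<open>An infimum lies below a bound iff some feasible point does, so attainment is not
    an issue.\<close>
  have gap: "las_integrality_gap n (n - 1) f \<longleftrightarrow>
      (\<exists>y\<in>las_feasible n (n - 1). las_objective n f y < f (ind_point n Iopt))"
    unfolding las_integrality_gap_def las_value_def INF_less_iff assms(5) by simp
  have feasible: "y \<in> las_feasible n (n - 1) \<longleftrightarrow> ?one z \<and>
      (\<forall>p. (\<Sum>S\<in>Pow ?N. (-1) ^ card S * p S) = 0 \<longrightarrow> 0 \<le> (\<Sum>S\<in>Pow ?N. z S * (p S)\<^sup>2))"
    and objective: "las_objective n f y = (\<Sum>S\<in>Pow ?N. z S * f (ind_point n S))"
    if y: "\<forall>I. I \<subseteq> ?N \<longrightarrow> y I = (\<Sum>S | I \<subseteq> S \<and> S \<subseteq> ?N. z S)" for y z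
  proof -
    \<comment> \<open>Every subset contains the empty set, so normalizing \<open>y\<close> amounts
      to \<open>z\<close> summing to 1.\<close>
    have "y {} = sum z (Pow ?N)" using y by (simp add: Pow_def)
    moreover have "psd_on (Pow ?N - {?N}) (moment_matrix y) \<longleftrightarrow>
        (\<forall>p. (\<Sum>S\<in>Pow ?N. (-1) ^ card S * p S) = 0 \<longrightarrow> 0 \<le> (\<Sum>S\<in>Pow ?N. z S * (p S)\<^sup>2))"
      using y by (intro psd_moment_matrix_iff finite_atLeastAtMost) blast
    ultimately show "y \<in> las_feasible n (n - 1) \<longleftrightarrow> ?one z \<and>
        (\<forall>p. (\<Sum>S\<in>Pow ?N. (-1) ^ card S * p S) = 0 \<longrightarrow> 0 \<le> (\<Sum>S\<in>Pow ?N. z S * (p S)\<^sup>2))"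
      unfolding las_feasible_def subsets_upto_pred[OF assms(1)] mem_Collect_eq by (simp only:)
    show "las_objective n f y = (\<Sum>S\<in>Pow ?N. z S * f (ind_point n S))"
      using y by (intro las_objective_eq) blast
  qed
  have fin: "finite (Pow ?N)" by simp
  have sign: "(-1 :: real) ^ card S * (-1) ^ card S = 1" for S :: "nat set"
    unfolding power_mult_distrib[symmetric] by simp
  have f_nonneg: "0 \<le> f (ind_point n S)" if "S \<subseteq> ?N" for S
  proof -
    have "finite (f ` cube n)" by (simp add: cube_eq_ind_points)
    moreover have "f (ind_point n S) \<in> f ` cube n"
      using that by (auto simp: cube_eq_ind_points)
    ultimately show ?thesis unfolding assms(2)[symmetric] by (rule Min_le)
  qed
  show ?thesis
  proof
    assume "las_integrality_gap n (n - 1) f"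
    then obtain y where y: "y \<in> las_feasible n (n - 1)"
      and obj: "las_objective n f y < f (ind_point n Iopt)"
      unfolding gap by blast
    obtain z where z: "\<forall>I. I \<subseteq> ?N \<longrightarrow> y I = (\<Sum>S | I \<subseteq> S \<and> S \<subseteq> ?N. z S)"
      using ex_superset_sum_coeffs[OF finite_atLeastAtMost, of 1 n y] by metis
    have obj: "?obj z" using obj unfolding objective[OF z] .
    have one: "?one z" using y unfolding feasible[OF z] by blast
    have nonneg: "0 \<le> (\<Sum>S\<in>Pow ?N. z S * (p S)\<^sup>2)"
      if "(\<Sum>S\<in>Pow ?N. (-1) ^ card S * p S) = 0" for p
      using that y unfolding feasible[OF z] by blast
    \<comment> \<open>Without a negative entry the objective would be nonnegative because
      \<open>f\<close> is, yet a gap puts it below the minimum 0.\<close>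
    obtain K where K: "K \<in> Pow ?N" "z K < 0"
    proof (rule ccontr)
      assume "\<not> thesis"
      then have "0 \<le> z S" if "S \<in> Pow ?N" for S
        using \<open>\<And>K. K \<in> Pow ?N \<Longrightarrow> z K < 0 \<Longrightarrow> thesis\<close>[OF that] by linarith
      then have "0 \<le> (\<Sum>S\<in>Pow ?N. z S * f (ind_point n S))"
        using f_nonneg by (intro sum_nonneg) simp
      then show False using obj unfolding assms(5,2) by linarith
    qed
    \<comment> \<open>As \<open>n \<ge> 1\<close>, the empty set and the full set are distinct, so
      there are entries other than the one at \<open>K\<close>.\<close>
    have "{} \<in> Pow ?N" "?N \<in> Pow ?N" "?N \<noteq> {}" using assms(1) by auto
    then have ne: "Pow ?N \<noteq> {K}" by (metis singletonD)
    have recip: "?recip z"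
      by (rule negative_entry_of_hyperplane_nonneg(2)[OF fin sign nonneg K ne])
    have "\<forall>J\<in>Pow ?N - {K}. 0 < z J"
      by (rule negative_entry_of_hyperplane_nonneg(1)[OF fin sign nonneg K])
    then have "?neg z" using K by blast
    then show "\<exists>z. ?obj z \<and> ?one z \<and> ?neg z \<and> ?recip z"
      using obj one recip by blast
  next
    assume "\<exists>z. ?obj z \<and> ?one z \<and> ?neg z \<and> ?recip z"
    then obtain z where z: "?obj z \<and> ?one z \<and> ?neg z \<and> ?recip z" by (rule exE)
    then have obj: "?obj z" and one: "?one z" and neg: "?neg z" and recip: "?recip z"
      by (simp_all only:)
    from neg obtain K where K: "K \<in> Pow ?N" "z K < 0"
      and pos: "\<And>J. J \<in> Pow ?N - {K} \<Longrightarrow> 0 < z J"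
      by (metis DiffD1 DiffD2 Pow_iff singletonI)
    \<comment> \<open>The moments are rebuilt by superset sums, which makes the given
      \<open>z\<close> their coordinates.\<close>
    define y where "y I = (\<Sum>S | I \<subseteq> S \<and> S \<subseteq> ?N. z S)" for I
    then have y: "\<forall>I. I \<subseteq> ?N \<longrightarrow> y I = (\<Sum>S | I \<subseteq> S \<and> S \<subseteq> ?N. z S)" by blast
    have "0 \<le> (\<Sum>S\<in>Pow ?N. z S * (p S)\<^sup>2)"
      if "(\<Sum>S\<in>Pow ?N. (-1) ^ card S * p S) = 0" for p
      by (rule hyperplane_nonneg_of_negative_entry[OF fin sign K pos recip that])
    then have "y \<in> las_feasible n (n - 1)"
      using one unfolding feasible[OF y] by blast
    moreover have "las_objective n f y < f (ind_point n Iopt)"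
      using obj unfolding objective[OF y] .
    ultimately show "las_integrality_gap n (n - 1) f"
      unfolding gap by blast
  qed
qed

end
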